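(* Let $D\subset \ell^\infty$ be a separable subspace with $D\cap c=\{0\}$, and let $E$ be a separable Banach space. Then there exists an isometry $T:E\to \ell^\infty$ such that $$T(E)\cap (D+c)=\{0\}.$$ In particular, there exists a subspace $Z\subset\ell^\infty$ such that $D\subset Z$, $Z$ contains an isometric copy of $E$, and $Z\cap c=\{0\}$.
   Context: The scalar field is $\mathbb{K}=\mathbb{R}$ or $\mathbb{C}$. $\ell^\infty$ is the Banach space of all bounded $\mathbb{K}$-valued sequences $(x_n)_{n=1}^\infty$ with the sup norm $\|\cdot\|_\infty$, and $c\subset\ell^\infty$ is the subspace of convergent sequences. Subspace means linear subspace (not necessarily closed; $Z$ is not claimed to be closed). Separability of $D$ is with respect to $\|\cdot\|_\infty$. "Isometry $T:E\to\ell^\infty$" means a linear isometric embedding, not necessarily onto: $T$ is linear and $\|T(x)\|_\infty=\|x\|$ for all $x\in E$. An isometric copy of $E$ is the image of such an embedding. *)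

theory Defs
  imports "HOL-Analysis.Analysis"
begin

text \<open>
  The space of bounded sequences over \<open>'k\<close> with the sup norm is the type \<open>nat \<Rightarrow>\<^sub>C 'k\<close> of
  bounded continuous functions: \<open>nat\<close> carries the discrete topology, so continuity is no
  restriction. Sequences are indexed from 0.
\<close>

text \<open>
  The library only provides the real scalar multiplication on \<open>nat \<Rightarrow>\<^sub>C 'k\<close>; the following is
  multiplication by scalars from \<open>'k\<close>.
\<close>

definition linf_scale :: "'k::real_normed_field \<Rightarrow> (nat \<Rightarrow>\<^sub>C 'k) \<Rightarrow> (nat \<Rightarrow>\<^sub>C 'k)" where
  "linf_scale a x = Bcontfun (\<lambda>n. a * apply_bcontfun x n)"

lemma bounded_seq_in_bcontfun: "bounded (range x) \<Longrightarrow> x \<in> bcontfun"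
  for x :: "nat \<Rightarrow> 'k::real_normed_field"
  by (simp add: bcontfun_def)

lemma linf_scale_apply [simp]: "apply_bcontfun (linf_scale a x) n = a * apply_bcontfun x n"
proof -
  have "bounded ((*) a ` range (apply_bcontfun x))"
    by (intro bounded_linear_image bounded_linear_mult_right) simp
  then have "(\<lambda>n. a * apply_bcontfun x n) \<in> bcontfun"
    by (intro bounded_seq_in_bcontfun) (simp add: image_image)
  then show ?thesis
    by (simp add: linf_scale_def Bcontfun_inverse)
qed

definition convergent_seqs :: "(nat \<Rightarrow>\<^sub>C 'k::real_normed_field) set" where
  "convergent_seqs = {x. convergent (apply_bcontfun x)}"

text \<open>
  The library has no class of complex normed spaces. One is rendered as a type with addition and
  norm from \<open>real_normed_vector\<close> together with a complex scalar multiplication that extends the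
  real one and for which the norm is homogeneous; on a type of class \<open>banach\<close> this gives a
  complex Banach space.
\<close>

locale complex_normed_space = vector_space scale
  for scale :: "complex \<Rightarrow> 'e::real_normed_vector \<Rightarrow> 'e" +
  assumes scale_of_real: "scale (complex_of_real r) x = r *\<^sub>R x"
    and norm_scale: "norm (scale a x) = cmod a * norm x"

definition linear_isometry ::
    "('k::field \<Rightarrow> 'e::real_normed_vector \<Rightarrow> 'e) \<Rightarrow> ('k \<Rightarrow> 'f::real_normed_vector \<Rightarrow> 'f)
      \<Rightarrow> ('e \<Rightarrow> 'f) \<Rightarrow> bool" where
  "linear_isometry s1 s2 T \<longleftrightarrow> Vector_Spaces.linear s1 s2 T \<and> (\<forall>x. norm (T x) = norm x)"

lemma linf_scale_real: "linf_scale = ((*\<^sub>R) :: real \<Rightarrow> (nat \<Rightarrow>\<^sub>C real) \<Rightarrow> _)"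
  by (intro ext bcontfun_eqI) simp

lemma norm_linf: "norm x = (SUP n. norm (apply_bcontfun x n))"
  for x :: "nat \<Rightarrow>\<^sub>C 'k::real_normed_field"
  by (simp add: norm_bcontfun_def dist_bcontfun.rep_eq)

lemma norm_linf_scale_le: "norm (linf_scale a x) \<le> norm a * norm x"
  unfolding norm_linf[of "linf_scale a x"]
  by (rule cSUP_least) (auto simp: norm_mult intro!: mult_left_mono norm_bounded)

lemma norm_linf_scale: "norm (linf_scale a x) = norm a * norm x"
proof (cases "a = 0")
  case True
  then have "linf_scale a x = 0"
    by (intro bcontfun_eqI) simp
  with True show ?thesis by simp
next
  case False
  have "linf_scale (inverse a) (linf_scale a x) = x"
    using False by (intro bcontfun_eqI) simp
  then have "norm x \<le> norm (inverse a) * norm (linf_scale a x)"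
    using norm_linf_scale_le[of "inverse a" "linf_scale a x"] by simp
  then have "norm a * norm x \<le> norm (linf_scale a x)"
    using False by (simp add: norm_divide norm_inverse divide_simps mult.commute)
  then show ?thesis
    using norm_linf_scale_le[of a x] by linarith
qed

interpretation linf: complex_normed_space "linf_scale :: complex \<Rightarrow> (nat \<Rightarrow>\<^sub>C complex) \<Rightarrow> _"
  by standard
    (auto intro!: bcontfun_eqI simp: norm_linf_scale algebra_simps scaleR_conv_of_real)

end

theory Submission
  imports Defs
begin

text \<open>
  Let \<open>\<phi>\<^sub>i\<close> be a norming sequence of functionals on \<open>E\<close>. For every set
  \<open>A\<close> of naturals, the values \<open>\<phi>\<^sub>i x\<close>, each repeated infinitely often for every
  \<open>k\<close> with a sign telling whether \<open>k \<in> A\<close>, form an isometric embedding \<open>T\<^sub>A\<close>. If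
  each of these uncountably many embeddings had a unit vector with
  \<open>T\<^sub>A x\<^sub>A = d\<^sub>A + c\<^sub>A \<in> D + c\<close>, then by separability two different sets
  \<open>A, B\<close> would have \<open>x\<^sub>A\<close>, \<open>d\<^sub>A\<close> and \<open>lim c\<^sub>A\<close> close to
  \<open>x\<^sub>B\<close>, \<open>d\<^sub>B\<close> and \<open>lim c\<^sub>B\<close>, so \<open>T\<^sub>A x\<^sub>A\<close> and
  \<open>T\<^sub>B x\<^sub>B\<close> would be close at all large indices; but at the indices of some
  \<open>k\<close> in the symmetric difference they are almost opposite.

  The norming functionals come from the Hahn-Banach theorem, proved by applying Zorn's lemma to
  sublinear functionals: the minimal ones are linear.
\<close>

section \<open>Norming functionals\<close>

text \<open>Positive homogeneity is asked as an inequality, the form in which infima deliver it;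
  equality follows by scaling back with \<open>inverse t\<close>.\<close>

definition sublinear :: "('a::real_vector \<Rightarrow> real) \<Rightarrow> bool" where
  "sublinear p \<longleftrightarrow> (\<forall>x y. p (x + y) \<le> p x + p y) \<and> (\<forall>t>0. \<forall>x. p (t *\<^sub>R x) \<le> t * p x)"

lemma sublinear_add: "sublinear p \<Longrightarrow> p (x + y) \<le> p x + p y"
  by (simp add: sublinear_def)

lemma sublinear_scale_le: "sublinear p \<Longrightarrow> 0 < t \<Longrightarrow> p (t *\<^sub>R x) \<le> t * p x"
  by (simp add: sublinear_def)

lemma sublinear_scale:
  assumes "sublinear p" and "0 < t"
  shows "p (t *\<^sub>R x) = t * p x"
proof -
  have "p x \<le> inverse t * p (t *\<^sub>R x)"
    using sublinear_scale_le[OF assms(1), of "inverse t" "t *\<^sub>R x"] assms(2) by simp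
  then have "t * p x \<le> p (t *\<^sub>R x)"
    using assms(2) by (simp add: field_simps)
  with sublinear_scale_le[OF assms] show ?thesis
    by (simp add: order_antisym)
qed

lemma sublinear_zero: "sublinear p \<Longrightarrow> p 0 = 0"
  using sublinear_scale[of p 2 0] by simp

lemma sublinear_ge: "sublinear p \<Longrightarrow> - p (- x) \<le> p x"
  using sublinear_add[of p x "- x"] sublinear_zero[of p] by simp

lemma sublinear_norm: "sublinear (norm :: 'a::real_normed_vector \<Rightarrow> real)"
  by (simp add: sublinear_def norm_triangle_ineq)

text \<open>The infima are finite because \<open>- q (- x) \<le> - p (- x) \<le> p x\<close> for
  every \<open>p\<close> in \<open>C\<close>. This supplies the lower bounds of chains for Zorn's
  lemma.\<close>

lemma sublinear_chain_Inf:
  assumes ne: "C \<noteq> {}"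
    and sub: "\<And>p. p \<in> C \<Longrightarrow> sublinear p"
    and le: "\<And>p x. p \<in> C \<Longrightarrow> p x \<le> q x"
    and chain: "\<And>p p'. p \<in> C \<Longrightarrow> p' \<in> C \<Longrightarrow> p \<le> p' \<or> p' \<le> p"
  shows "sublinear (\<lambda>x. INF p\<in>C. p x)"
    and "\<And>p x. p \<in> C \<Longrightarrow> (INF p\<in>C. p x) \<le> p x"
proof -
  have bdd: "bdd_below ((\<lambda>p. p x) ` C)" for x
  proof (rule bdd_belowI2)
    fix p assume "p \<in> C"
    then show "- q (- x) \<le> p x"
      using sublinear_ge[OF sub, of p x] le[of p "- x"] by linarith
  qed
  show lower: "\<And>p x. p \<in> C \<Longrightarrow> (INF p\<in>C. p x) \<le> p x"
    by (rule cINF_lower[OF bdd])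
  let ?u = "\<lambda>x. INF p\<in>C. p x"
  \<comment> \<open>The two infima on the right are taken separately, so \<open>p\<close> and
    \<open>p'\<close> must be independent; the smaller of the two serves for both.\<close>
  have *: "?u (x + y) \<le> p x + p' y" if p: "p \<in> C" and p': "p' \<in> C" for p p' x y
  proof -
    obtain r where r: "r \<in> C" "r \<le> p" "r \<le> p'"
      using chain[OF p p'] p p' by blast
    have "?u (x + y) \<le> r (x + y)"
      using r by (intro lower)
    also have "\<dots> \<le> r x + r y"
      using sub[OF r(1)] by (rule sublinear_add)
    also have "\<dots> \<le> p x + p' y"
      using le_funD[OF r(2)] le_funD[OF r(3)] by (rule add_mono)
    finally show ?thesis .
  qed
  show "sublinear ?u"
    unfolding sublinear_def
  proof (intro conjI allI impI)
    fix x y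
    have "?u (x + y) - p x \<le> ?u y" if "p \<in> C" for p
      using *[OF that] by (intro cINF_greatest[OF ne]) (simp add: algebra_simps)
    then have "?u (x + y) - ?u y \<le> ?u x"
      by (intro cINF_greatest[OF ne]) (simp add: algebra_simps)
    then show "?u (x + y) \<le> ?u x + ?u y"
      by simp
  next
    fix t :: real and x assume t: "0 < t"
    have "?u (t *\<^sub>R x) / t \<le> ?u x"
    proof (rule cINF_greatest[OF ne])
      fix p assume p: "p \<in> C"
      have "?u (t *\<^sub>R x) \<le> t * p x"
        using lower[OF p, of "t *\<^sub>R x"] by (simp add: sublinear_scale[OF sub[OF p] t])
      then show "?u (t *\<^sub>R x) / t \<le> p x"
        using t by (simp add: field_simps)
    qed
    then show "?u (t *\<^sub>R x) \<le> t * ?u x"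
      using t by (simp add: field_simps)
  qed
qed

text \<open>Lowers \<open>p\<close> as far as possible subject to the value at \<open>- y\<close> dropping to \<open>- p y\<close>.\<close>

lemma sublinear_lowering:
  assumes p: "sublinear p"
  obtains p' where "sublinear p'" "p' \<le> p" "\<And>x. p' x \<le> p (x + y) - p y"
proof -
  define p' where "p' x = (INF t\<in>{0..}. p (x + t *\<^sub>R y) - t * p y)" for x
  have bdd: "bdd_below ((\<lambda>t. p (x + t *\<^sub>R y) - t * p y) ` {0..})" for x
  proof (rule bdd_belowI2)
    fix t :: real assume "t \<in> {0..}"
    then have "p (t *\<^sub>R y) = t * p y"
      using sublinear_scale[OF p, of t y] sublinear_zero[OF p] by (cases "t = 0") auto
    \<comment> \<open>\<open>t *\<^sub>R y\<close> is the sum of \<open>- x\<close> and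
      \<open>x + t *\<^sub>R y\<close>, which gives a bound that does not depend on
      \<open>t\<close>.\<close>
    then show "- p (- x) \<le> p (x + t *\<^sub>R y) - t * p y"
      using sublinear_add[OF p, of "- x" "x + t *\<^sub>R y"] by simp
  qed
  have lower: "p' x \<le> p (x + t *\<^sub>R y) - t * p y" if "0 \<le> t" for x t
    unfolding p'_def by (rule cINF_lower[OF bdd]) (use that in simp)
  have greatest: "c \<le> p' x" if "\<And>t. 0 \<le> t \<Longrightarrow> c \<le> p (x + t *\<^sub>R y) - t * p y" for c x
    unfolding p'_def by (rule cINF_greatest) (use that in auto)
  have "sublinear p'"
    unfolding sublinear_def
  proof (intro conjI allI impI)
    fix a b
    \<comment> \<open>Parameters \<open>s\<close> for \<open>a\<close> and \<open>t\<close> for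
      \<open>b\<close> combine to the admissible parameter \<open>s + t\<close> for
      \<open>a + b\<close>.\<close>
    have *: "p' (a + b) \<le> (p (a + s *\<^sub>R y) - s * p y) + (p (b + t *\<^sub>R y) - t * p y)"
      if "0 \<le> s" "0 \<le> t" for s t
    proof -
      have "p' (a + b) \<le> p (a + b + (s + t) *\<^sub>R y) - (s + t) * p y"
        using that by (intro lower) simp
      also have "a + b + (s + t) *\<^sub>R y = (a + s *\<^sub>R y) + (b + t *\<^sub>R y)"
        by (simp add: algebra_simps)
      also have "p \<dots> - (s + t) * p y
          \<le> (p (a + s *\<^sub>R y) - s * p y) + (p (b + t *\<^sub>R y) - t * p y)"
        using sublinear_add[OF p, of "a + s *\<^sub>R y" "b + t *\<^sub>R y"] by (simp add: algebra_simps)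
      finally show ?thesis .
    qed
    have "p' (a + b) - (p (a + s *\<^sub>R y) - s * p y) \<le> p' b" if "0 \<le> s" for s
      by (rule greatest) (use *[OF that] in \<open>simp add: algebra_simps\<close>)
    then have "p' (a + b) - p' b \<le> p' a"
      by (intro greatest) (simp add: algebra_simps)
    then show "p' (a + b) \<le> p' a + p' b"
      by simp
  next
    fix r :: real and x assume r: "0 < r"
    have "p' (r *\<^sub>R x) / r \<le> p' x"
    proof (rule greatest)
      fix t :: real assume t: "0 \<le> t"
      have "p' (r *\<^sub>R x) \<le> p (r *\<^sub>R x + (r * t) *\<^sub>R y) - (r * t) * p y"
        using r t by (intro lower) simp
      also have "r *\<^sub>R x + (r * t) *\<^sub>R y = r *\<^sub>R (x + t *\<^sub>R y)"
        by (simp add: algebra_simps)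
      also have "p \<dots> - (r * t) * p y = r * (p (x + t *\<^sub>R y) - t * p y)"
        by (simp only: sublinear_scale[OF p r]) (simp add: algebra_simps)
      finally show "p' (r *\<^sub>R x) / r \<le> p (x + t *\<^sub>R y) - t * p y"
        using r by (simp add: field_simps)
    qed
    then show "p' (r *\<^sub>R x) \<le> r * p' x"
      using r by (simp add: field_simps)
  qed
  moreover have "p' \<le> p"
    using lower[of 0] by (intro le_funI) simp
  moreover have "p' x \<le> p (x + y) - p y" for x
    using lower[of 1 x] by simp
  ultimately show ?thesis ..
qed

text \<open>Lowering cannot change a minimal \<open>p\<close>, so the bound on the lowered
  functional holds for \<open>p\<close> itself: \<open>p x \<le> p (x + y) - p y\<close>, the
  converse of subadditivity.\<close>

lemma minimal_sublinear_linear: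
  assumes p: "sublinear p" and min: "\<And>p'. sublinear p' \<Longrightarrow> p' \<le> p \<Longrightarrow> p' = p"
  shows "linear p"
proof -
  have add: "p (x + y) = p x + p y" for x y
  proof -
    obtain p' where p': "sublinear p'" "p' \<le> p" "\<And>x. p' x \<le> p (x + y) - p y"
      using sublinear_lowering[OF p, of y] by metis
    then have "p x \<le> p (x + y) - p y"
      using min by blast
    with sublinear_add[OF p, of x y] show ?thesis
      by simp
  qed
  have neg: "p (- x) = - p x" for x
    using add[of x "- x"] sublinear_zero[OF p] by simp
  have "p (t *\<^sub>R x) = t * p x" for t x
  proof (cases t "0::real" rule: linorder_cases)
    case less
    then show ?thesis
      using sublinear_scale[OF p, of "- t" x] neg[of "t *\<^sub>R x"] by simp
  qed (simp_all add: sublinear_zero[OF p] sublinear_scale[OF p])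
  with add show ?thesis
    by (intro linearI) simp_all
qed

section \<open>Hahn-Banach theorem and norming functionals\<close>

theorem hahn_banach_sublinear:
  assumes q: "sublinear q"
  obtains f where "linear f" "f \<le> q"
proof -
  \<comment> \<open>The order is reversed, so a maximal element in Zorn's lemma is a minimal
    sublinear functional.\<close>
  let ?A = "{p. sublinear p \<and> p \<le> q}" and ?P = "\<lambda>p p' :: 'a \<Rightarrow> real. p' \<le> p"
  have "\<exists>m\<in>?A. \<forall>p\<in>?A. ?P m p \<longrightarrow> p = m"
  proof (rule predicate_Zorn)
    show "partial_order_on ?A (relation_of ?P ?A)"
      by (rule partial_order_on_relation_ofI) auto
  next
    fix C assume "C \<in> Chains (relation_of ?P ?A)"
    then have C: "\<And>p. p \<in> C \<Longrightarrow> sublinear p \<and> p \<le> q"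
      "\<And>p p'. p \<in> C \<Longrightarrow> p' \<in> C \<Longrightarrow> p \<le> p' \<or> p' \<le> p"
      unfolding Chains_def relation_of_def by blast+
    show "\<exists>u\<in>?A. \<forall>p\<in>C. ?P p u"
    proof (cases "C = {}")
      case True
      with q show ?thesis by auto
    next
      case False
      let ?u = "\<lambda>x. INF p\<in>C. p x"
      have u: "sublinear ?u" "\<And>p x. p \<in> C \<Longrightarrow> ?u x \<le> p x"
        using sublinear_chain_Inf[OF False, of q] C by (auto dest: le_funD)
      obtain p where "p \<in> C"
        using False by blast
      then have "p \<le> q"
        using C(1) by blast
      then have "?u \<le> q"
        using u(2)[OF \<open>p \<in> C\<close>] by (auto simp: le_fun_def intro: order_trans)
      with u show ?thesis
        by (intro bexI[of _ ?u]) (auto intro!: le_funI)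
    qed
  qed
  then obtain m where m: "sublinear m" "m \<le> q"
    and min: "\<And>p. sublinear p \<Longrightarrow> p \<le> q \<Longrightarrow> p \<le> m \<Longrightarrow> p = m"
    by blast
  have "linear m"
    using m min by (intro minimal_sublinear_linear) (auto intro: order_trans)
  with m that show ?thesis
    by blast
qed

lemma real_norming_functional:
  fixes x0 :: "'a::real_normed_vector"
  obtains f :: "'a \<Rightarrow> real" where "linear f" "\<And>x. \<bar>f x\<bar> \<le> norm x" "f x0 = norm x0"
proof -
  \<comment> \<open>At \<open>x = - x0\<close> the last bound reads
    \<open>q (- x0) \<le> - norm x0\<close>, so every linear functional below \<open>q\<close>
    attains the norm at \<open>x0\<close>.\<close>
  obtain q where q: "sublinear q" "q \<le> norm" "\<And>x. q x \<le> norm (x + x0) - norm x0"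
    using sublinear_lowering[OF sublinear_norm, of x0] by metis
  obtain f where f: "linear f" "f \<le> q"
    using hahn_banach_sublinear[OF q(1)] .
  have le: "f x \<le> norm x" for x
    using f(2) q(2) by (meson le_funD order_trans)
  have neg: "f (- x) = - f x" for x
    using f(1) by (rule linear_neg)
  have "\<bar>f x\<bar> \<le> norm x" for x
    using le[of x] le[of "- x"] neg[of x] by simp
  moreover have "f x0 = norm x0"
  proof -
    have "f (- x0) \<le> q (- x0)"
      using f(2) by (rule le_funD)
    then show ?thesis
      using q(3)[of "- x0"] neg[of x0] le[of x0] by simp
  qed
  ultimately show ?thesis
    using that f(1) by blast
qed

text \<open>Common setting for both scalar fields: the Hahn-Banach theorem enters only through
  \<open>norming\<close>, and second countability provides a countable dense set of scalars.\<close>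

locale norming_space = vector_space scale
  for scale :: "'k::{real_normed_field, second_countable_topology} \<Rightarrow> 'e::real_normed_vector \<Rightarrow> 'e" +
  assumes norm_scale: "norm (scale a x) = norm a * norm x"
    and norming: "\<exists>f. Vector_Spaces.linear scale (*) f \<and> (\<forall>x. norm (f x) \<le> norm x) \<and>
      norm (f x0) = norm x0"

lemma norming_space_real: "norming_space ((*\<^sub>R) :: real \<Rightarrow> 'e::real_normed_vector \<Rightarrow> 'e)"
proof
  fix x0 :: 'e
  obtain f :: "'e \<Rightarrow> real" where f: "linear f" "\<And>x. \<bar>f x\<bar> \<le> norm x" "f x0 = norm x0"
    using real_norming_functional[of x0] by blast
  have "Vector_Spaces.linear (*\<^sub>R) (*) f"
    using f(1) unfolding linear_def real_scaleR_def[abs_def] .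
  with f show "\<exists>f :: 'e \<Rightarrow> real. Vector_Spaces.linear (*\<^sub>R) (*) f \<and>
      (\<forall>x. norm (f x) \<le> norm x) \<and> norm (f x0) = norm x0"
    by auto
qed (simp_all add: algebra_simps)

context complex_normed_space
begin

text \<open>A complex linear functional is recovered from its real part \<open>f\<close> as
  \<open>f x - \<i> * f (scale \<i> x)\<close>; this formula turns any real linear \<open>f\<close>
  into a complex linear one.\<close>

lemma complexification_linear:
  assumes f: "linear f"
  shows "Vector_Spaces.linear scale (*) (\<lambda>x. Complex (f x) (- f (scale \<i> x)))"
proof -
  have add: "f (x + y) = f x + f y" for x y
    using f by (rule linear_add)
  have scale_f: "f (scale (Complex a b) x) = a * f x + b * f (scale \<i> x)" for a b x
  proof -
    have "scale (Complex a b) x = scale (of_real a) x + scale (of_real b) (scale \<i> x)"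
      by (simp add: Complex_eq scale_left_distrib[symmetric] mult.commute)
    then show ?thesis
      by (simp only: add scale_of_real linear_cmul[OF f] real_scaleR_def)
  qed
  interpret C: vector_space "(*) :: complex \<Rightarrow> complex \<Rightarrow> complex"
    by standard (simp_all add: algebra_simps)
  show ?thesis
  proof
    fix x y
    show "Complex (f (x + y)) (- f (scale \<i> (x + y))) =
        Complex (f x) (- f (scale \<i> x)) + Complex (f y) (- f (scale \<i> y))"
      by (simp add: add scale_right_distrib complex_eq_iff)
  next
    fix r x
    obtain a b where r: "r = Complex a b"
      by (cases r)
    have ir: "\<i> * Complex a b = Complex (- b) a"
      by (simp add: complex_eq_iff)
    have "scale \<i> (scale r x) = scale (Complex (- b) a) x"
      by (simp add: r ir)
    then show "Complex (f (scale r x)) (- f (scale \<i> (scale r x))) =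
        r * Complex (f x) (- f (scale \<i> x))"
      by (simp add: r ir scale_f complex_eq_iff[of "Complex _ _"] del: scale_scale)
  qed
qed

lemma norming_space_complex: "norming_space scale"
proof
  fix x0 :: 'e
  obtain f :: "'e \<Rightarrow> real" where f: "linear f" "\<And>x. \<bar>f x\<bar> \<le> norm x" "f x0 = norm x0"
    using real_norming_functional[of x0] by blast
  define g where "g x = Complex (f x) (- f (scale \<i> x))" for x
  have lin: "Vector_Spaces.linear scale (*) g"
    unfolding g_def[abs_def] using f(1) by (rule complexification_linear)
  interpret g: Vector_Spaces.linear scale "(*)" g
    by (rule lin)
  have le: "cmod (g x) \<le> norm x" for x
  proof -
    \<comment> \<open>Multiplying by \<open>?u\<close> rotates \<open>g x\<close> to its modulus;
      the value there is real, hence given by \<open>f\<close>, and \<open>?u\<close> has modulus at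
      most 1.\<close>
    let ?u = "cnj (sgn (g x))"
    have "of_real (cmod (g x)) = ?u * g x"
      using complex_norm_square[of "g x"]
      by (cases "g x = 0") (simp_all add: sgn_eq eq_divide_eq power2_eq_square mult.commute)
    also have "\<dots> = g (scale ?u x)"
      by (simp add: g.scale)
    finally have "cmod (g x) = f (scale ?u x)"
      by (simp add: g_def complex_eq_iff)
    also have "\<dots> \<le> norm (scale ?u x)"
      using f(2)[of "scale ?u x"] by linarith
    also have "\<dots> \<le> norm x"
      by (simp add: norm_scale norm_sgn)
    finally show ?thesis .
  qed
  \<comment> \<open>The real part of \<open>g x0\<close> is \<open>f x0 = norm x0\<close>, which
    bounds the modulus from below.\<close>
  moreover have "cmod (g x0) = norm x0"
    using le[of x0] abs_Re_le_cmod[of "g x0"] f(3) by (simp add: g_def)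
  ultimately show "\<exists>g. Vector_Spaces.linear scale (*) g \<and> (\<forall>x. cmod (g x) \<le> norm x) \<and>
      cmod (g x0) = norm x0"
    using lin by blast
qed (rule norm_scale)

end

section \<open>Separable subspaces\<close>

lemma separable_spaceE:
  fixes S :: "'a::metric_space set"
  assumes "separable_space (top_of_set S)"
  obtains Q where "countable Q" "\<And>x e. x \<in> S \<Longrightarrow> 0 < e \<Longrightarrow> \<exists>q\<in>Q. dist x q < e"
proof -
  obtain Q where Q: "countable Q" "Q \<subseteq> S" "(top_of_set S) closure_of Q = S"
    using assms by (auto simp: separable_space_def)
  then have "S \<subseteq> closure Q"
    using closure_mono[of "S \<inter> Q" Q] by (auto simp: closure_of_subtopology)
  then have "\<exists>q\<in>Q. dist x q < e" if "x \<in> S" "0 < e" for x e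
    using that by (metis closure_approachable dist_commute subsetD)
  with Q(1) that show ?thesis
    by blast
qed

lemma linf_vector_space: "vector_space (linf_scale :: 'k::real_normed_field \<Rightarrow> _)"
  by standard (auto intro!: bcontfun_eqI simp: algebra_simps)

lemma convergent_seqs_subspace:
  "module.subspace linf_scale (convergent_seqs :: (nat \<Rightarrow>\<^sub>C 'k::real_normed_field) set)"
proof -
  interpret L: vector_space "linf_scale :: 'k \<Rightarrow> _"
    by (rule linf_vector_space)
  have "convergent (\<lambda>n. a * apply_bcontfun x n)" if "convergent (apply_bcontfun x)" for a :: 'k and x
    using that by (intro convergent_mult convergent_const)
  then show ?thesis
    by (intro L.subspaceI)
      (auto simp: convergent_seqs_def linf_scale_apply[abs_def] intro: convergent_add convergent_const)
qed

lemma convergent_seqs_limit: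
  assumes "c \<in> convergent_seqs"
  obtains l where "\<And>e. 0 < e \<Longrightarrow> \<forall>\<^sub>F n in sequentially. dist (apply_bcontfun c n) l < e"
  using assms that by (auto simp: convergent_seqs_def convergent_def tendsto_iff)

section \<open>Norming sequences and signed embeddings\<close>

context norming_space
begin

text \<open>One functional is taken for each point of a countable dense set. It does not increase
  norms, so it is still almost norming at points near its own.\<close>

lemma norming_sequence:
  assumes "separable_space (euclidean :: 'e topology)"
  obtains \<phi> :: "nat \<Rightarrow> 'e \<Rightarrow> 'k"
  where "\<And>i. Vector_Spaces.linear scale (*) (\<phi> i)" "\<And>i x. norm (\<phi> i x) \<le> norm x"
    "\<And>x e. 0 < e \<Longrightarrow> \<exists>i. norm x - e < norm (\<phi> i x)"
proof -
  obtain Q :: "'e set" where Q: "countable Q" "\<And>x e. 0 < e \<Longrightarrow> \<exists>q\<in>Q. dist x q < e"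
    using separable_spaceE[of "UNIV :: 'e set"] assms by auto
  then have ne: "Q \<noteq> {}"
    using zero_less_one by blast
  have "\<exists>f. \<forall>x0. Vector_Spaces.linear scale (*) (f x0) \<and> (\<forall>x. norm (f x0 x) \<le> norm x) \<and>
      norm (f x0 x0 :: 'k) = norm x0"
    using norming by metis
  then obtain f where f: "\<And>x0. Vector_Spaces.linear scale (*) (f x0)"
    "\<And>x0 x. norm (f x0 x) \<le> norm x" "\<And>x0. norm (f x0 x0 :: 'k) = norm x0"
    by blast
  show ?thesis
  proof (rule that[of "\<lambda>i. f (from_nat_into Q i)"])
    fix x :: 'e and e :: real assume "0 < e"
    \<comment> \<open>The distance is paid twice: once from \<open>norm x\<close> to
      \<open>norm q\<close>, once from \<open>f q q\<close> to \<open>f q x\<close>.\<close>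
    then obtain q where q: "q \<in> Q" "dist x q < e / 2"
      using Q(2)[of "e / 2"] by auto
    interpret fq: Vector_Spaces.linear scale "(*)" "f q"
      by (rule f)
    have "norm q \<le> norm (f q x) + norm (f q (q - x))"
      using norm_triangle_ineq[of "f q x" "f q (q - x)"] f(3)[of q] by (simp add: fq.diff)
    also have "norm (f q (q - x)) \<le> norm (q - x)"
      by (rule f)
    finally have "norm x - e < norm (f q x)"
      using q(2) norm_triangle_sub[of x q] by (simp add: dist_norm norm_minus_commute)
    then show "\<exists>i. norm x - e < norm (f (from_nat_into Q i) x)"
      using from_nat_into_surj[OF Q(1) q(1)] by metis
  qed (use f in auto)
qed

text \<open>
  Index \<open>m\<close> codes \<open>((i, k), j)\<close>: functional \<open>i\<close>, sign determined by \<open>k \<in> A\<close>, and \<open>j\<close>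
  makes every pair \<open>(i, k)\<close> recur at arbitrarily large indices, so that
  differences survive the passage to tails modulo convergent sequences.
\<close>

definition signed_embedding :: "(nat \<Rightarrow> 'e \<Rightarrow> 'k) \<Rightarrow> nat set \<Rightarrow> 'e \<Rightarrow> (nat \<Rightarrow>\<^sub>C 'k)" where
  "signed_embedding \<phi> A x = Bcontfun (\<lambda>m. case prod_decode (fst (prod_decode m)) of
     (i, k) \<Rightarrow> if k \<in> A then \<phi> i x else - \<phi> i x)"

context
  fixes \<phi> :: "nat \<Rightarrow> 'e \<Rightarrow> 'k"
  assumes linear: "\<And>i. Vector_Spaces.linear scale (*) (\<phi> i)"
    and norm_le: "\<And>i x. norm (\<phi> i x) \<le> norm x"
    and norm_gt: "\<And>x e. 0 < e \<Longrightarrow> \<exists>i. norm x - e < norm (\<phi> i x)"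
begin

lemma \<phi>_add: "\<phi> i (x + y) = \<phi> i x + \<phi> i y"
  and \<phi>_diff: "\<phi> i (x - y) = \<phi> i x - \<phi> i y"
  and \<phi>_scale: "\<phi> i (scale a x) = a * \<phi> i x"
proof -
  interpret Vector_Spaces.linear scale "(*)" "\<phi> i"
    by (rule linear)
  show "\<phi> i (x + y) = \<phi> i x + \<phi> i y" "\<phi> i (x - y) = \<phi> i x - \<phi> i y"
    "\<phi> i (scale a x) = a * \<phi> i x"
    by (rule add diff scale)+
qed

lemma signed_embedding_apply:
  "apply_bcontfun (signed_embedding \<phi> A x) m = (case prod_decode (fst (prod_decode m)) of
     (i, k) \<Rightarrow> if k \<in> A then \<phi> i x else - \<phi> i x)"
proof -
  have "(\<lambda>m. case prod_decode (fst (prod_decode m)) of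
      (i, k) \<Rightarrow> if k \<in> A then \<phi> i x else - \<phi> i x) \<in> bcontfun"
    by (intro bounded_seq_in_bcontfun boundedI[of _ "norm x"]) (auto split: prod.splits simp: norm_le)
  then show ?thesis
    by (simp add: signed_embedding_def Bcontfun_inverse)
qed

text \<open>Signs do not affect moduli and every \<open>\<phi> i\<close> occurs at some index, so
  the sup norm is the supremum of \<open>norm (\<phi> i x)\<close>, which is
  \<open>norm x\<close>.\<close>

lemma signed_embedding_isometry: "linear_isometry scale linf_scale (signed_embedding \<phi> A)"
proof -
  interpret L: vector_space "linf_scale :: 'k \<Rightarrow> _"
    by (rule linf_vector_space)
  have "Vector_Spaces.linear scale linf_scale (signed_embedding \<phi> A)"
    by standard (auto intro!: bcontfun_eqI
        simp: signed_embedding_apply \<phi>_add \<phi>_scale split: prod.splits)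
  moreover have "norm (signed_embedding \<phi> A x) = norm x" for x
  proof (rule antisym)
    show "norm (signed_embedding \<phi> A x) \<le> norm x"
      unfolding norm_linf
      by (rule cSUP_least) (auto simp: signed_embedding_apply norm_le split: prod.splits)
    show "norm x \<le> norm (signed_embedding \<phi> A x)"
    proof (rule field_le_epsilon)
      fix e :: real assume "0 < e"
      then obtain i where "norm x - e < norm (\<phi> i x)"
        using norm_gt by blast
      also have "\<dots> = norm (signed_embedding \<phi> A x (prod_encode (prod_encode (i, 0), 0)))"
        by (simp add: signed_embedding_apply)
      also have "\<dots> \<le> norm (signed_embedding \<phi> A x)"
        by (rule norm_bounded)
      finally show "norm x \<le> norm (signed_embedding \<phi> A x) + e"
        by simp
    qed
  qed
  ultimately show ?thesis
    by (simp add: linear_isometry_def)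
qed

text \<open>Opposite signs turn the difference of the two images into a sum close to
  \<open>2 * \<phi> i x\<close> up to sign. Far out, \<open>c\<close> and \<open>c'\<close> are
  nearly \<open>l\<close> and \<open>l'\<close>, so only the distance of \<open>l\<close> and
  \<open>l'\<close> can account for its size.\<close>

lemma signed_embedding_separated:
  assumes "A \<noteq> B" and x: "norm x = 1" and "dist x y < 1/4"
    and Tx: "signed_embedding \<phi> A x = d + c" and Ty: "signed_embedding \<phi> B y = d' + c'"
    and "dist d d' < 1/4"
    and c: "\<forall>\<^sub>F n in sequentially. dist (apply_bcontfun c n) l < 1/8"
    and c': "\<forall>\<^sub>F n in sequentially. dist (apply_bcontfun c' n) l' < 1/8"
  shows "1/4 \<le> dist l l'"
proof (rule ccontr)
  assume "\<not> 1/4 \<le> dist l l'"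
  obtain k where k: "k \<in> A \<longleftrightarrow> k \<notin> B"
    using \<open>A \<noteq> B\<close> by blast
  obtain i where i: "3/4 < norm (\<phi> i x)"
    using norm_gt[of "1/4" x] x by auto
  obtain N where N: "\<And>n. N \<le> n \<Longrightarrow> dist (apply_bcontfun c n) l < 1/8"
    "\<And>n. N \<le> n \<Longrightarrow> dist (apply_bcontfun c' n) l' < 1/8"
    using eventually_conj[OF c c'] by (auto simp: eventually_sequentially)
  \<comment> \<open>The free last component pushes the index beyond \<open>N\<close> without
    changing the functional or the sign.\<close>
  define m where "m = prod_encode (prod_encode (i, k), N)"
  have "N \<le> m"
    unfolding m_def by (rule le_prod_encode_2)
  have "apply_bcontfun (signed_embedding \<phi> A x) m - apply_bcontfun (signed_embedding \<phi> B y) m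
      \<in> {\<phi> i x + \<phi> i y, - (\<phi> i x + \<phi> i y)}"
    using k by (auto simp: m_def signed_embedding_apply)
  then have "norm (\<phi> i x + \<phi> i y) = dist (apply_bcontfun (signed_embedding \<phi> A x) m)
      (apply_bcontfun (signed_embedding \<phi> B y) m)"
    unfolding dist_norm by (metis empty_iff insert_iff norm_minus_cancel)
  also have "\<dots> \<le> dist (apply_bcontfun d m) (apply_bcontfun d' m)
      + dist (apply_bcontfun c m) (apply_bcontfun c' m)"
    unfolding Tx Ty plus_bcontfun.rep_eq dist_norm by (rule norm_diff_triangle_ineq)
  also have "dist (apply_bcontfun d m) (apply_bcontfun d' m) \<le> dist d d'"
    by (rule dist_bounded)
  also have "dist (apply_bcontfun c m) (apply_bcontfun c' m)
      \<le> dist (apply_bcontfun c m) l + dist l l' + dist (apply_bcontfun c' m) l'"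
    using dist_triangle[of "apply_bcontfun c m" "apply_bcontfun c' m" l]
      dist_triangle[of l "apply_bcontfun c' m" l'] by (simp add: dist_commute)
  \<comment> \<open>1/4 from \<open>d\<close> and \<open>d'\<close>, 1/4 from \<open>l\<close> and
    \<open>l'\<close>, and 1/8 each from \<open>c\<close> and \<open>c'\<close>.\<close>
  finally have "norm (\<phi> i x + \<phi> i y) < 3/4"
    using N[OF \<open>N \<le> m\<close>] \<open>\<not> 1/4 \<le> dist l l'\<close> \<open>dist d d' < 1/4\<close> by linarith
  \<comment> \<open>The right side is less than 3/4 + 1/4 = 1, while the left side exceeds 3/2 by
    the choice of \<open>i\<close>.\<close>
  moreover have "2 * norm (\<phi> i x) \<le> norm (\<phi> i x + \<phi> i y) + norm (\<phi> i (x - y))"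
    using norm_triangle_ineq[of "\<phi> i x + \<phi> i y" "\<phi> i (x - y)"] by (simp add: \<phi>_diff)
  moreover have "norm (\<phi> i (x - y)) < 1/4"
    using norm_le[of i "x - y"] \<open>dist x y < 1/4\<close> by (simp add: dist_norm)
  ultimately show False
    using i by linarith
qed

end

section \<open>Uncountably many embeddings against separability\<close>

theorem isometry_avoiding_separable:
  assumes D: "module.subspace linf_scale D" and sepD: "separable_space (top_of_set D)"
    and sepE: "separable_space (euclidean :: 'e topology)"
  obtains T :: "'e \<Rightarrow> (nat \<Rightarrow>\<^sub>C 'k)"
  where "linear_isometry scale linf_scale T" "range T \<inter> (D + convergent_seqs) = {0}"
proof -
  interpret L: vector_space "linf_scale :: 'k \<Rightarrow> _"
    by (rule linf_vector_space)
  obtain \<phi> :: "nat \<Rightarrow> 'e \<Rightarrow> 'k"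
    where \<phi>: "\<And>i. Vector_Spaces.linear scale (*) (\<phi> i)" "\<And>i x. norm (\<phi> i x) \<le> norm x"
      "\<And>x e. 0 < e \<Longrightarrow> \<exists>i. norm x - e < norm (\<phi> i x)"
    using norming_sequence[OF sepE] by metis
  define T where "T = signed_embedding \<phi>"
  have iso: "linear_isometry scale linf_scale (T A)" for A
    unfolding T_def using \<phi> by (rule signed_embedding_isometry)
  have "\<exists>A. range (T A) \<inter> (D + convergent_seqs) \<subseteq> {0}"
  proof (rule ccontr)
    assume neg: "\<not> ?thesis"
    have "\<exists>x d c l. norm x = 1 \<and> d \<in> D \<and> T A x = d + c \<and>
        (\<forall>e>0. \<forall>\<^sub>F n in sequentially. dist (apply_bcontfun c n) l < e)" for A
    proof -
      interpret T: Vector_Spaces.linear scale linf_scale "T A"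
        using iso by (simp add: linear_isometry_def)
      obtain x d c where x: "T A x \<noteq> 0" "T A x = d + c" "d \<in> D" "c \<in> convergent_seqs"
        using neg by (force elim: set_plus_elim)
      \<comment> \<open>The vector is normalised; the decomposition scales along with it, since
        \<open>D\<close> and the convergent sequences are subspaces.\<close>
      define a :: 'k where "a = inverse (of_real (norm x))"
      have "x \<noteq> 0"
        using x(1) T.zero by auto
      then have "norm (scale a x) = 1"
        by (simp add: norm_scale a_def norm_inverse)
      moreover have "linf_scale a d \<in> D"
        using D x(3) by (rule L.subspace_scale)
      moreover have "T A (scale a x) = linf_scale a d + linf_scale a c"
        by (simp add: T.scale x(2) L.scale_right_distrib)
      moreover have "linf_scale a c \<in> convergent_seqs"
        using convergent_seqs_subspace x(4) by (rule L.subspace_scale)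
      ultimately show ?thesis
        by (metis convergent_seqs_limit)
    qed
    then obtain x d c l where *: "\<And>A. norm (x A) = 1" "\<And>A. d A \<in> D" "\<And>A. T A (x A) = d A + c A"
      "\<And>A e. 0 < e \<Longrightarrow> \<forall>\<^sub>F n in sequentially. dist (apply_bcontfun (c A) n) (l A) < e"
      by metis
    obtain QE :: "'e set" where QE: "countable QE" "\<And>x e. 0 < e \<Longrightarrow> \<exists>q\<in>QE. dist x q < e"
      using separable_spaceE[of "UNIV :: 'e set"] sepE by auto
    obtain QD where QD: "countable QD" "\<And>x e. x \<in> D \<Longrightarrow> 0 < e \<Longrightarrow> \<exists>q\<in>QD. dist x q < e"
      using separable_spaceE[OF sepD] by metis
    obtain QK :: "'k set" where "countable QK" and QK: "\<And>U. open U \<Longrightarrow> U \<noteq> {} \<Longrightarrow> \<exists>q\<in>QK. q \<in> U"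
      using countable_dense_setE by blast
    then have QK: "countable QK" "\<And>x e. 0 < e \<Longrightarrow> \<exists>q\<in>QK. dist x q < e"
      using QK[OF open_ball] by (auto simp: not_le)
    \<comment> \<open>Each set gets a code in a countable set. Accuracy 1/8 puts the data of two
      sets with the same code within 1/4 of each other.\<close>
    have "\<exists>q. \<forall>A. q A \<in> QE \<times> QD \<times> QK \<and> dist (x A) (fst (q A)) < 1/8 \<and>
        dist (d A) (fst (snd (q A))) < 1/8 \<and> dist (l A) (snd (snd (q A))) < 1/8"
    proof (rule choice, rule allI)
      fix A
      obtain q1 q2 q3 where "q1 \<in> QE" "dist (x A) q1 < 1/8" "q2 \<in> QD" "dist (d A) q2 < 1/8"
        "q3 \<in> QK" "dist (l A) q3 < 1/8"
        using QE(2)[of "1/8" "x A"] QD(2)[OF *(2), of "1/8" A] QK(2)[of "1/8" "l A"] by auto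
      then show "\<exists>q. q \<in> QE \<times> QD \<times> QK \<and> dist (x A) (fst q) < 1/8 \<and>
          dist (d A) (fst (snd q)) < 1/8 \<and> dist (l A) (snd (snd q)) < 1/8"
        by (intro exI[of _ "(q1, q2, q3)"]) simp
    qed
    then obtain q where q: "\<And>A. q A \<in> QE \<times> QD \<times> QK" "\<And>A. dist (x A) (fst (q A)) < 1/8"
      "\<And>A. dist (d A) (fst (snd (q A))) < 1/8" "\<And>A. dist (l A) (snd (snd (q A))) < 1/8"
      by blast
    \<comment> \<open>Distinct sets with the same code would contradict the separation of limits, so
      \<open>q\<close> injects the power set of the naturals into a countable set.\<close>
    have "inj q"
    proof (rule injI, rule ccontr)
      fix A B assume eq: "q A = q B" and "A \<noteq> B"
      have "dist (x A) (x B) < 1/4" "dist (d A) (d B) < 1/4" "dist (l A) (l B) < 1/4"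
        using q(2-4)[of A, unfolded eq] q(2-4)[of B]
          dist_triangle2[of "x A" "x B" "fst (q B)"] dist_triangle2[of "d A" "d B" "fst (snd (q B))"]
          dist_triangle2[of "l A" "l B" "snd (snd (q B))"]
        by linarith+
      then have "1/4 \<le> dist (l A) (l B)"
        by (intro signed_embedding_separated[OF \<phi> \<open>A \<noteq> B\<close> *(1) _ *(3)[unfolded T_def]
          *(3)[unfolded T_def] _ *(4) *(4)]) simp_all
      with \<open>dist (l A) (l B) < 1/4\<close> show False
        by simp
    qed
    moreover have "countable (range q)"
    proof (rule countable_subset)
      show "range q \<subseteq> QE \<times> QD \<times> QK"
        using q(1) by (rule image_subsetI)
      show "countable (QE \<times> QD \<times> QK)"
        using QE(1) QD(1) QK(1) by (intro countable_SIGMA)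
    qed
    ultimately have "countable (UNIV :: nat set set)"
      by (simp add: countable_image_inj_eq)
    then obtain f :: "nat \<Rightarrow> nat set" where "range f = UNIV"
      using uncountable_def[of "UNIV :: nat set set"] by blast
    then show False
      using Cantors_theorem[of "UNIV :: nat set"] by auto
  qed
  then obtain A where A: "range (T A) \<inter> (D + convergent_seqs) \<subseteq> {0}"
    by blast
  interpret T: Vector_Spaces.linear scale linf_scale "T A"
    using iso by (simp add: linear_isometry_def)
  have "0 \<in> range (T A)"
    using T.zero by (metis rangeI)
  moreover have "0 + 0 \<in> D + convergent_seqs"
    using D convergent_seqs_subspace by (intro set_plus_intro L.subspace_0)
  ultimately show ?thesis
    using A iso by (intro that[of "T A"]) auto
qed

text \<open>The sum of \<open>D\<close> and \<open>range T\<close> serves as \<open>Z\<close>, with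
  \<open>T\<close> itself as the embedding \<open>S\<close>.\<close>

corollary isometry_and_extension:
  assumes D: "module.subspace linf_scale D" and "separable_space (top_of_set D)"
    and Dc: "D \<inter> convergent_seqs = {0}"
    and "separable_space (euclidean :: 'e topology)"
  shows "(\<exists>T :: 'e \<Rightarrow> (nat \<Rightarrow>\<^sub>C 'k).
      linear_isometry scale linf_scale T \<and> range T \<inter> (D + convergent_seqs) = {0}) \<and>
    (\<exists>Z. module.subspace linf_scale Z \<and> D \<subseteq> Z \<and>
      (\<exists>S :: 'e \<Rightarrow> (nat \<Rightarrow>\<^sub>C 'k). linear_isometry scale linf_scale S \<and> range S \<subseteq> Z) \<and>
      Z \<inter> convergent_seqs = {0})"
proof -
  interpret L: vector_space "linf_scale :: 'k \<Rightarrow> _"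
    by (rule linf_vector_space)
  obtain T :: "'e \<Rightarrow> (nat \<Rightarrow>\<^sub>C 'k)"
    where iso: "linear_isometry scale linf_scale T"
      and T: "range T \<inter> (D + convergent_seqs) = {0}"
    using isometry_avoiding_separable[OF assms(1,2,4)] .
  interpret T: Vector_Spaces.linear scale linf_scale T
    using iso by (simp add: linear_isometry_def)
  define Z where "Z = {d + t | d t. d \<in> D \<and> t \<in> range T}"
  have range: "L.subspace (range T)"
    using T.subspace_image[OF subspace_UNIV] .
  have Z: "L.subspace Z"
    unfolding Z_def using D range by (rule L.subspace_sums)
  have "D \<subseteq> Z" "range T \<subseteq> Z"
    unfolding Z_def using L.subspace_0[OF D] L.subspace_0[OF range] by force+
  moreover have "Z \<inter> convergent_seqs = {0}"
  proof
    show "Z \<inter> convergent_seqs \<subseteq> {0}"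
    proof
      fix z assume z: "z \<in> Z \<inter> convergent_seqs"
      then obtain d x where d: "d \<in> D" "z = d + T x"
        by (auto simp: Z_def)
      \<comment> \<open>This element is \<open>T x\<close>, so \<open>T x = 0\<close> by the choice
        of \<open>T\<close>. Then \<open>z = d\<close> is a convergent element of \<open>D\<close>,
        hence zero.\<close>
      have "- d + z \<in> D + convergent_seqs"
        using z L.subspace_neg[OF D d(1)] by (intro set_plus_intro) simp_all
      then have "T x \<in> D + convergent_seqs"
        by (simp add: d(2))
      then have "T x = 0"
        using T by blast
      then show "z \<in> {0}"
        using Dc d z by auto
    qed
    show "{0} \<subseteq> Z \<inter> convergent_seqs"
      using L.subspace_0[OF Z] L.subspace_0[OF convergent_seqs_subspace] by simp
  qed
  ultimately show ?thesis
    using iso T Z by blast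
qed

end

section \<open>The real and the complex case\<close>

theorem proposition3p2:
  shows
    "(\<forall>D :: (nat \<Rightarrow>\<^sub>C real) set.
        subspace D \<and> separable_space (top_of_set D) \<and> D \<inter> convergent_seqs = {0} \<and>
        separable_space (euclidean :: 'e::banach topology)
        \<longrightarrow>
        (\<exists>T :: 'e \<Rightarrow> (nat \<Rightarrow>\<^sub>C real).
            linear_isometry (*\<^sub>R) (*\<^sub>R) T \<and> range T \<inter> (D + convergent_seqs) = {0}) \<and>
        (\<exists>Z :: (nat \<Rightarrow>\<^sub>C real) set.
            subspace Z \<and> D \<subseteq> Z \<and>
            (\<exists>S :: 'e \<Rightarrow> (nat \<Rightarrow>\<^sub>C real). linear_isometry (*\<^sub>R) (*\<^sub>R) S \<and> range S \<subseteq> Z) \<and>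
            Z \<inter> convergent_seqs = {0}))
     \<and>
     (\<forall>(D :: (nat \<Rightarrow>\<^sub>C complex) set) (scale :: complex \<Rightarrow> 'f::banach \<Rightarrow> 'f).
        module.subspace linf_scale D \<and> separable_space (top_of_set D) \<and>
        D \<inter> convergent_seqs = {0} \<and>
        complex_normed_space scale \<and> separable_space (euclidean :: 'f topology)
        \<longrightarrow>
        (\<exists>T :: 'f \<Rightarrow> (nat \<Rightarrow>\<^sub>C complex).
            linear_isometry scale linf_scale T \<and> range T \<inter> (D + convergent_seqs) = {0}) \<and>
        (\<exists>Z :: (nat \<Rightarrow>\<^sub>C complex) set.
            module.subspace linf_scale Z \<and> D \<subseteq> Z \<and>
            (\<exists>S :: 'f \<Rightarrow> (nat \<Rightarrow>\<^sub>C complex). linear_isometry scale linf_scale S \<and> range S \<subseteq> Z) \<and>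
            Z \<inter> convergent_seqs = {0}))"
\<comment> \<open>Only the two scalar fields are separated; the conjunction inside each case stays
  whole, as the corollary proves it.\<close>
proof (intro conjI[of "All _" "All _"] allI impI)
  fix D :: "(nat \<Rightarrow>\<^sub>C real) set"
  assume asm: "subspace D \<and> separable_space (top_of_set D) \<and> D \<inter> convergent_seqs = {0} \<and>
    separable_space (euclidean :: 'e topology)"
  interpret norming_space "(*\<^sub>R) :: real \<Rightarrow> 'e \<Rightarrow> 'e"
    by (rule norming_space_real)
  show "(\<exists>T :: 'e \<Rightarrow> (nat \<Rightarrow>\<^sub>C real).
        linear_isometry (*\<^sub>R) (*\<^sub>R) T \<and> range T \<inter> (D + convergent_seqs) = {0}) \<and>
      (\<exists>Z :: (nat \<Rightarrow>\<^sub>C real) set.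
        subspace Z \<and> D \<subseteq> Z \<and>
        (\<exists>S :: 'e \<Rightarrow> (nat \<Rightarrow>\<^sub>C real). linear_isometry (*\<^sub>R) (*\<^sub>R) S \<and> range S \<subseteq> Z) \<and>
        Z \<inter> convergent_seqs = {0})"
    \<comment> \<open>Over the reals \<open>linf_scale\<close> is the ordinary real scalar
      multiplication, so the general notions of subspace and isometry become the real ones.\<close>
    using isometry_and_extension[of D] asm by (simp add: linf_scale_real subspace_raw_def)
next
  fix D :: "(nat \<Rightarrow>\<^sub>C complex) set" and scale :: "complex \<Rightarrow> 'f \<Rightarrow> 'f"
  assume asm: "module.subspace linf_scale D \<and> separable_space (top_of_set D) \<and>
    D \<inter> convergent_seqs = {0} \<and>
    complex_normed_space scale \<and> separable_space (euclidean :: 'f topology)"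
  interpret norming_space scale
    using asm by (intro complex_normed_space.norming_space_complex) blast
  show "(\<exists>T :: 'f \<Rightarrow> (nat \<Rightarrow>\<^sub>C complex).
        linear_isometry scale linf_scale T \<and> range T \<inter> (D + convergent_seqs) = {0}) \<and>
      (\<exists>Z :: (nat \<Rightarrow>\<^sub>C complex) set.
        module.subspace linf_scale Z \<and> D \<subseteq> Z \<and>
        (\<exists>S :: 'f \<Rightarrow> (nat \<Rightarrow>\<^sub>C complex). linear_isometry scale linf_scale S \<and> range S \<subseteq> Z) \<and>
        Z \<inter> convergent_seqs = {0})"
    using asm by (intro isometry_and_extension) blast+
qed

end
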